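(* Let $m\geq 1$, $n\geq 1$ and $d\in\mathbf{Z}$ be integers. If $d$ is coprime to $n$, then the cardinality of $H_{n,d}$ equals $\mathrm{DT}_n^{(m)}$.
   Context: Fix an integer $m\ge1$. For $n\geq 1$ and $d\in\mathbf{Z}$, $H_{n,d}$ is the set of all sequences $(l_1,\ldots,l_n)\in\mathbf{Z}^n$ such that (1) $l_{k+1}-l_k+(m-1)\geq 0$ for all $k=1,\ldots,n-1$; (2) $\sum_{i=1}^n l_i=d$; (3) $\frac{1}{k}\sum_{i=1}^k l_i\geq\frac{d}{n}$ for all $1\le k<n$. Let $F(t)\in\mathbf{Z}[[t]]$ be the unique power series with $F(t)=1+tF(t)^m$ (the generating series $\sum_n\chi(\mathrm{Hilb}_n^{(m)})t^n$ of Euler characteristics of the noncommutative Hilbert schemes of the free algebra in $m$ variables). The numbers $\mathrm{DT}_n^{(m)}\in\mathbf{Q}$, $n\geq1$, are uniquely defined by $$F((-1)^{m-1}t)=\prod_{n\geq 1}(1-t^n)^{-(-1)^{(m-1)n}\,n\,\mathrm{DT}_n^{(m)}}.$$ *)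

theory Defs
  imports "HOL-Analysis.Infinite_Products" "HOL-Computational_Algebra.Formal_Power_Series"
begin

(* The sequence (l_1, ..., l_n) is the list l, so that l_k is l ! (k - 1). *)
definition H_set :: "nat \<Rightarrow> nat \<Rightarrow> int \<Rightarrow> int list set" where
  "H_set m n d = {l. length l = n \<and>
      (\<forall>k. 1 \<le> k \<and> k \<le> n - 1 \<longrightarrow> l ! k - l ! (k - 1) + (int m - 1) \<ge> 0) \<and>
      (\<Sum>i<n. l ! i) = d \<and>
      (\<forall>k. 1 \<le> k \<and> k < n \<longrightarrow>
         1 / rat_of_nat k * (\<Sum>i<k. rat_of_int (l ! i)) \<ge> rat_of_int d / rat_of_nat n)}"

(* The series F, which generates the Euler characteristics of the noncommutative Hilbert schemes. *)
definition euler_series :: "nat \<Rightarrow> int fps" where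
  "euler_series m = (THE f. f = 1 + fps_X * f ^ m)"

(* The series (1 - t^n)^a for n \<ge> 1 and a rational exponent a: fps_binomial a is (1 + t)^a. *)
definition one_minus_power :: "nat \<Rightarrow> rat \<Rightarrow> rat fps" where
  "one_minus_power n a = fps_binomial a oo (- (fps_X ^ n))"

(* The infinite product is a limit in the t-adic metric on formal power series.  It runs over
   n \<ge> 1, so its factors are indexed by Suc i; the unused entry D 0 is pinned to 0 to make D unique. *)
definition DT :: "nat \<Rightarrow> nat \<Rightarrow> rat" where
  "DT m = (THE D. D 0 = 0 \<and>
     (\<lambda>i. let n = Suc i in
        one_minus_power n (- ((- 1) ^ ((m - 1) * n) * of_nat n * D n)))
     has_prod (Abs_fps (\<lambda>k. of_int (fps_nth (euler_series m) k)) oo (fps_const ((- 1) ^ (m - 1)) * fps_X)))"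

end

theory Submission
  imports Defs "HOL-Computational_Algebra.Formal_Laurent_Series"
begin

text \<open>
  Both sides are identified with the solution \<open>D\<close> of
  \<open>(\<Sum>n | n dvd N. (-1)^((m-1)*n) * n^2 * D n) = (-1)^((m-1)*N) * ((m*N-1) choose (N-1))\<close>.

  For the numbers \<open>DT m n\<close>, this is what comes out of applying \<open>f \<mapsto> t f' / f\<close> to the product formula:
  the coefficients of \<open>t F' / F\<close> are given by Lagrange inversion.

  For the sets \<open>H_set m n d\<close>, the condition (3) forces \<open>l_1 \<ge> l_n\<close>, hence condition (1) also holds
  cyclically, and by the cycle lemma exactly one rotation of each cyclic sequence satisfies (3).
  The cyclic sequences correspond to their shifted differences \<open>a_j \<ge> 0\<close>, with \<open>\<Sum> a_j = n (m - 1)\<close>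
  and \<open>\<Sum> j a_j\<close> in a fixed residue class modulo \<open>n\<close>.  Counting these with \<open>n\<close>-th roots of unity
  \<open>\<zeta>\<close> gives a sum over \<open>s\<close> of \<open>\<zeta>^(s d) * U (gcd s n)\<close>, where \<open>U N\<close> is the right-hand side above; it
  does not depend on \<open>d\<close> coprime to \<open>n\<close>, and summing it over the divisors \<open>n\<close> of \<open>N\<close> leaves \<open>U N\<close>.
\<close>

unbundle no vec_syntax

section \<open>The logarithmic derivative of power series\<close>

lemma fps_compose_X_power_nth:
  fixes f :: "'a::field fps"
  assumes "e > 0"
  shows "(f oo fps_X ^ e) $ N = (if e dvd N then f $ (N div e) else 0)"
proof -
  have "(f oo fps_X ^ e) $ N = (\<Sum>i=0..N. if i * e = N then f $ i else 0)"
    unfolding fps_compose_nth by (intro sum.cong) (auto simp: mult.commute simp flip: power_mult)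
  also have "\<dots> = (\<Sum>i=0..N. if e dvd N \<and> i = N div e then f $ i else 0)"
    using assms by (intro sum.cong) auto
  also have "\<dots> = (if e dvd N then f $ (N div e) else 0)"
    by auto
  finally show ?thesis .
qed

lemma fps_prod_nth_0: "(\<Prod>i\<in>A. f i) $ 0 = (\<Prod>i\<in>A. (f i :: 'a::comm_ring_1 fps) $ 0)"
  by (induction A rule: infinite_finite_induct) simp_all

text \<open>The factor \<open>fps_X\<close> undoes the index shift of the derivative, so the divisor
  sums extracted from products of powers of 1 - t^n appear at their own index.\<close>

definition log_deriv :: "'a::field_char_0 fps \<Rightarrow> 'a fps" where
  "log_deriv f = fps_X * fps_deriv f * inverse f"

lemma log_deriv_mult_self:
  "f $ 0 \<noteq> 0 \<Longrightarrow> log_deriv f * f = fps_X * fps_deriv f"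
  by (simp add: log_deriv_def mult.assoc inverse_mult_eq_1)

lemma log_deriv_eqI:
  assumes "f $ 0 \<noteq> 0" "h * f = fps_X * fps_deriv f"
  shows "log_deriv f = h"
proof -
  have "f \<noteq> 0" using assms(1) by auto
  then show ?thesis using assms log_deriv_mult_self[OF assms(1)] by (metis mult_right_cancel)
qed

lemma fps_X_deriv_X_power: "fps_X * fps_deriv (fps_X ^ n) = (of_nat n * fps_X ^ n :: 'a::field_char_0 fps)"
proof (rule fps_ext)
  fix N
  show "(fps_X * fps_deriv (fps_X ^ n)) $ N = (of_nat n * fps_X ^ n :: 'a fps) $ N"
    by (cases N) (auto simp flip: fps_of_nat)
qed

lemma log_deriv_1 [simp]: "log_deriv 1 = 0"
  by (simp add: log_deriv_def)

lemma log_deriv_nth_0 [simp]: "log_deriv f $ 0 = 0"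
  by (simp add: log_deriv_def mult.assoc)

lemma log_deriv_mult:
  assumes "f $ 0 \<noteq> 0" "g $ 0 \<noteq> 0"
  shows "log_deriv (f * g) = log_deriv f + log_deriv g"
proof (rule log_deriv_eqI)
  have "(log_deriv f + log_deriv g) * (f * g) = (log_deriv f * f) * g + f * (log_deriv g * g)"
    by (simp add: algebra_simps)
  also have "\<dots> = fps_X * fps_deriv (f * g)"
    unfolding log_deriv_mult_self[OF assms(1)] log_deriv_mult_self[OF assms(2)] by (simp add: algebra_simps)
  finally show "(log_deriv f + log_deriv g) * (f * g) = fps_X * fps_deriv (f * g)" .
qed (use assms in simp)

lemma log_deriv_prod:
  assumes "finite A" "\<And>i. i \<in> A \<Longrightarrow> f i $ 0 \<noteq> 0"
  shows "(\<Prod>i\<in>A. f i) $ 0 \<noteq> 0 \<and> log_deriv (\<Prod>i\<in>A. f i) = (\<Sum>i\<in>A. log_deriv (f i))"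
  using assms by (induction A) (auto simp: log_deriv_mult)

lemma log_deriv_power:
  assumes "f $ 0 \<noteq> 0"
  shows "log_deriv (f ^ k) = of_nat k * log_deriv f"
  using log_deriv_prod[of "{..<k}" "\<lambda>_. f"] assms by simp

lemma log_deriv_inverse:
  assumes "f $ 0 \<noteq> 0"
  shows "log_deriv (inverse f) = - log_deriv f"
  using log_deriv_mult[OF assms, of "inverse f"] assms
  by (simp add: inverse_mult_eq_1' add_eq_0_iff)

text \<open>The hypotheses on \<open>u\<close> make it a monomial c t^e, for which the chain rule
  costs only a factor e. This covers both t replaced by c t and t replaced by t^e.\<close>

lemma log_deriv_compose:
  assumes "f $ 0 \<noteq> 0" and u0: "u $ 0 = 0" and u: "fps_X * fps_deriv u = of_nat e * u"
  shows "log_deriv (f oo u) = of_nat e * (log_deriv f oo u)"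
proof (rule log_deriv_eqI)
  have "(log_deriv f oo u) * (f oo u) = u * (fps_deriv f oo u)"
    using arg_cong[OF log_deriv_mult_self[OF assms(1)], of "\<lambda>h. h oo u"] u0
    by (simp add: fps_compose_mult_distrib)
  then show "of_nat e * (log_deriv f oo u) * (f oo u) = fps_X * fps_deriv (f oo u)"
    unfolding fps_compose_deriv[OF u0] by (metis (no_types, lifting) u mult.assoc mult.commute)
qed (use assms in auto)

lemma log_deriv_recurrence:
  assumes "f $ 0 \<noteq> 0"
  shows "of_nat N * f $ N = (\<Sum>i=0..N. log_deriv f $ i * f $ (N - i))"
proof -
  have "of_nat N * f $ N = (fps_X * fps_deriv f) $ N"
    by (cases N) auto
  also have "\<dots> = (\<Sum>i=0..N. log_deriv f $ i * f $ (N - i))"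
    unfolding log_deriv_mult_self[OF assms, symmetric] by (rule fps_mult_nth)
  finally show ?thesis .
qed

text \<open>Since \<open>log_deriv f $ 0 = 0\<close>, the recurrence expresses N f_N through lower
  coefficients of f. The truncated form serves to compare infinite products coefficient by
  coefficient.\<close>

lemma log_deriv_determines:
  assumes "f $ 0 = g $ 0" "f $ 0 \<noteq> 0" "\<And>j. j \<le> N \<Longrightarrow> log_deriv f $ j = log_deriv g $ j"
  shows "f $ N = g $ N"
  using assms(3)
proof (induction N rule: less_induct)
  case (less N)
  show ?case
  proof (cases "N = 0")
    case False
    have "log_deriv f $ i * f $ (N - i) = log_deriv g $ i * g $ (N - i)" if "i \<in> {0..N}" for i
      using that less False by (cases "i = 0") auto
    then have "of_nat N * f $ N = of_nat N * g $ N"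
      using assms by (simp add: log_deriv_recurrence)
    then show ?thesis using False by simp
  qed (use assms in simp)
qed

lemma log_deriv_eq_imp_eq:
  assumes "f $ 0 = g $ 0" "f $ 0 \<noteq> 0" "log_deriv f = log_deriv g"
  shows "f = g"
  using assms log_deriv_determines[of f g] by (auto simp: fps_eq_iff)

text \<open>The recurrence read the other way: its last term \<open>log_deriv f $ N * f $ 0\<close>
  can be solved for because \<open>f $ 0\<close> is nonzero.\<close>

lemma log_deriv_nth_cong:
  assumes "f $ 0 \<noteq> 0" "\<And>j. j \<le> N \<Longrightarrow> f $ j = g $ j"
  shows "log_deriv f $ N = log_deriv g $ N"
  using assms(2)
proof (induction N rule: less_induct)
  case (less N)
  have fg: "f $ 0 = g $ 0" using less by simp
  have s: "(\<Sum>i<N. log_deriv f $ i * f $ (N - i)) = (\<Sum>i<N. log_deriv g $ i * g $ (N - i))"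
    using less by (intro sum.cong) auto
  have "of_nat N * h $ N = (\<Sum>i<N. log_deriv h $ i * h $ (N - i)) + log_deriv h $ N * h $ 0"
    if "h $ 0 \<noteq> 0" for h :: "'a fps"
    using log_deriv_recurrence[OF that, of N] by (simp add: atLeast0AtMost flip: lessThan_Suc_atMost)
  from this[of f] this[of g] s fg assms(1) less.prems[of N]
  show ?case by simp
qed

lemma log_deriv_inverse_one_minus_const_X:
  fixes z :: "'a::field_char_0"
  shows "log_deriv (inverse (1 - fps_const z * fps_X)) $ N = (if N = 0 then 0 else z ^ N)"
proof -
  have "log_deriv (1 - fps_const z * fps_X) = - (fps_const z * (fps_X * inverse (1 - fps_const z * fps_X)))"
    by (simp add: log_deriv_def mult.left_commute flip: fps_const_neg)
  then have "log_deriv (inverse (1 - fps_const z * fps_X)) = fps_const z * (fps_X * inverse (1 - fps_const z * fps_X))"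
    by (simp add: log_deriv_inverse)
  then show ?thesis
    using one_minus_const_fps_X_neg_power'[of 1 z] by (cases N) auto
qed

text \<open>The equation makes \<open>h\<close> the series c (t^n + t^(2n) + ...); comparing
  coefficients leads from N to N - n.\<close>

lemma fps_geometric_X_power:
  fixes h :: "'a::field fps"
  assumes "n > 0" "h * (1 - fps_X ^ n) = fps_const c * fps_X ^ n"
  shows "h $ N = (if N > 0 \<and> n dvd N then c else 0)"
proof (induction N rule: less_induct)
  case (less N)
  have "(h * (1 - fps_X ^ n)) $ N = h $ N - (if N < n then 0 else h $ (N - n))"
    by (simp add: algebra_simps fps_X_power_mult_right_nth)
  moreover have "(h * (1 - fps_X ^ n)) $ N = (if N = n then c else 0)"
    unfolding assms(2) by simp
  ultimately have hN: "h $ N = (if N = n then c else 0) + (if N < n then 0 else h $ (N - n))"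
    by (simp add: algebra_simps)
  show ?case
  proof (cases "N < n")
    case True
    then show ?thesis using hN by (auto dest: dvd_imp_le)
  next
    case False
    then have "n dvd N - n \<longleftrightarrow> n dvd N" by (simp add: dvd_minus_self)
    then show ?thesis using hN False less[of "N - n"] assms(1) by auto
  qed
qed

lemma one_minus_power_nth_0 [simp]: "one_minus_power n a $ 0 = 1"
  by (simp add: one_minus_power_def)

lemma log_deriv_one_minus_power:
  assumes "n > 0"
  shows "log_deriv (one_minus_power n a) $ N = (if N > 0 \<and> n dvd N then - of_nat n * a else 0)"
proof (rule fps_geometric_X_power[OF assms])
  define u :: "rat fps" where "u = - (fps_X ^ n)"
  define f where "f = one_minus_power n a"
  have f: "f = fps_binomial a oo u" by (simp add: f_def u_def one_minus_power_def)
  have u0: "u $ 0 = 0" using assms by (simp add: u_def)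
  \<comment> \<open>The binomial series B satisfies (1 + t) B' = a B; substituting \<open>u\<close>
    turns this into a differential equation for \<open>f\<close>.\<close>
  have "(1 + fps_X) * fps_deriv (fps_binomial a) = fps_const a * fps_binomial a"
    unfolding fps_binomial_deriv by (simp add: fps_divide_unit mult.left_commute inverse_mult_eq_1')
  from arg_cong[OF this, of "\<lambda>h. h oo u"] u0
  have "(1 + u) * (fps_deriv (fps_binomial a) oo u) = fps_const a * f"
    by (simp add: fps_compose_mult_distrib fps_compose_add_distrib f)
  then have d: "(1 + u) * fps_deriv f = fps_const a * f * fps_deriv u"
    by (simp add: f fps_compose_deriv[OF u0] flip: mult.assoc)
  have Xu: "fps_X * fps_deriv u = - of_nat n * fps_X ^ n"
    by (simp add: u_def fps_X_deriv_X_power)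
  have "f * (log_deriv f * (1 + u)) = (log_deriv f * f) * (1 + u)" by (simp add: algebra_simps)
  also have "\<dots> = fps_X * ((1 + u) * fps_deriv f)"
    by (subst log_deriv_mult_self) (simp_all add: f_def algebra_simps)
  also have "\<dots> = f * (fps_const a * (fps_X * fps_deriv u))"
    unfolding d by (simp add: algebra_simps)
  finally have "log_deriv f * (1 + u) = fps_const a * (- of_nat n * fps_X ^ n)"
    unfolding Xu using one_minus_power_nth_0[of n a] by (metis f_def fps_zero_nth mult_left_cancel zero_neq_one)
  then show "log_deriv (one_minus_power n a) * (1 - fps_X ^ n) = fps_const (- of_nat n * a) * fps_X ^ n"
    unfolding fps_const_mult[symmetric] fps_const_neg[symmetric] fps_of_nat by (simp add: f_def u_def mult_ac)
qed

section \<open>The series F and the numbers DT\<close>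

definition rat_fps :: "int fps \<Rightarrow> rat fps" where
  "rat_fps f = Abs_fps (\<lambda>k. of_int (f $ k))"

lemma rat_fps_mult: "rat_fps (f * g) = rat_fps f * rat_fps g"
  by (simp add: rat_fps_def fps_eq_iff fps_mult_nth)

lemma rat_fps_power: "rat_fps (f ^ k) = rat_fps f ^ k"
  by (induction k) (simp_all add: rat_fps_mult, simp add: rat_fps_def fps_eq_iff)

lemma fps_power_nth_cong:
  assumes "\<And>j. j \<le> N \<Longrightarrow> f $ j = (g :: 'a::comm_ring_1 fps) $ j"
  shows "(f ^ k) $ N = (g ^ k) $ N"
  using assms
proof (induction k arbitrary: N)
  case (Suc k)
  then show ?case by (auto simp: fps_mult_nth intro!: sum.cong)
qed simp

text \<open>Because of the factor \<open>fps_X\<close>, coefficient N of the right-hand side depends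
  only on coefficients below N.\<close>

lemma algebraic_equation_unique:
  fixes f g :: "int fps"
  assumes "f = 1 + fps_X * f ^ m" "g = 1 + fps_X * g ^ m"
  shows "f = g"
proof -
  have "f $ N = g $ N" for N
  proof (induction N rule: less_induct)
    case (less N)
    then have "N > 0 \<Longrightarrow> (f ^ m) $ (N - 1) = (g ^ m) $ (N - 1)"
      by (intro fps_power_nth_cong) auto
    moreover have eq: "h $ N = (if N = 0 then 1 else (h ^ m) $ (N - 1))" if "h = 1 + fps_X * h ^ m" for h :: "int fps"
      by (subst that) auto
    ultimately show ?case using eq[OF assms(1)] eq[OF assms(2)] by (cases "N = 0") simp_all
  qed
  then show ?thesis by (simp add: fps_eq_iff)
qed

lemma algebraic_equation_exists: "\<exists>f :: int fps. f = 1 + fps_X * f ^ m"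
proof -
  define G :: "int fps \<Rightarrow> int fps" where "G f = 1 + fps_X * f ^ m" for f
  define a where "a k = (G ^^ k) 0" for k
  have aS: "a (Suc k) = G (a k)" for k by (simp add: a_def)
  have step: "a (Suc k) $ j = a k $ j" if "j < k" for j k
    using that
  proof (induction k arbitrary: j)
    case (Suc k)
    have "(a (Suc k) ^ m) $ (j - 1) = (a k ^ m) $ (j - 1)" if "j > 0"
      using that Suc by (intro fps_power_nth_cong) auto
    then show ?case unfolding aS[of "Suc k"] aS[of k] G_def by (cases "j = 0") (auto simp: aS G_def)
  qed simp
  have stable: "a k $ j = a (Suc j) $ j" if "j < k" for j k
    using that by (induction k) (auto simp: less_Suc_eq step)
  \<comment> \<open>Each application of \<open>G\<close> settles one more coefficient; coefficient j
    is final from \<open>a (Suc j)\<close> on, so the limit is read off the diagonal.\<close>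
  define f where "f = Abs_fps (\<lambda>j. a (Suc j) $ j)"
  have "f $ j = G f $ j" for j
  proof (cases j)
    case (Suc i)
    have "f $ j = (a j ^ m) $ i" by (simp add: f_def aS G_def Suc)
    also have "\<dots> = (f ^ m) $ i"
      using Suc by (intro fps_power_nth_cong) (simp add: f_def, rule stable, simp)
    finally show ?thesis by (simp add: G_def Suc)
  qed (simp add: f_def aS G_def)
  then have "f = G f" by (rule fps_ext)
  then show ?thesis unfolding G_def by (rule exI)
qed

lemma euler_series_eq: "euler_series m = 1 + fps_X * euler_series m ^ m"
  unfolding euler_series_def
  by (rule theI', rule ex_ex1I[OF algebraic_equation_exists]) (rule algebraic_equation_unique)

lemma rat_euler_series_eq:
  "rat_fps (euler_series m) = 1 + fps_X * rat_fps (euler_series m) ^ m"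
proof -
  have "rat_fps (euler_series m) = rat_fps (1 + fps_X * euler_series m ^ m)"
    using euler_series_eq by metis
  also have "\<dots> = 1 + fps_X * rat_fps (euler_series m ^ m)"
    by (simp add: rat_fps_def fps_eq_iff)
  finally show ?thesis by (simp add: rat_fps_power)
qed

section \<open>Residues and Lagrange inversion\<close>

lemma fls_residue_power_deriv:
  fixes w :: "'a::field_char_0 fls"
  shows "fls_residue (w ^ k * fls_deriv w) = 0"
proof -
  have "fls_deriv (w ^ Suc k) = of_int (int (Suc k)) * (w ^ k * fls_deriv w)"
    by (simp only: fls_deriv_power of_int_of_nat_eq diff_Suc_1 mult.assoc)
  then have "of_int (int (Suc k)) * fls_residue (w ^ k * fls_deriv w) = 0"
    by (metis fls_residue_deriv fls_residue_of_int_times(1))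
  then show ?thesis by (metis mult_eq_0_iff of_int_of_nat_eq of_nat_neq_0)
qed

text \<open>The integrand is w^(j-N) w'. It is itself a derivative unless the exponent is -1, when
  it is the logarithmic derivative, whose residue is the order of w. Exponents below -1 are reduced
  to nonnegative ones through \<open>inverse w\<close>.\<close>

lemma fls_residue_power_times_deriv:
  fixes w :: "'a::field_char_0 fls"
  assumes "w \<noteq> 0"
  shows "fls_residue (w ^ j * fls_deriv w / w ^ N) = (if N = Suc j then of_int (fls_subdegree w) else 0)"
proof (cases "N \<le> j")
  case True
  then have "w ^ j * fls_deriv w / w ^ N = w ^ (j - N) * fls_deriv w"
    using assms by (simp add: power_diff)
  then show ?thesis using True fls_residue_power_deriv[of w "j - N"] by simp
next
  case False
  then obtain k where N: "N = j + Suc k" using less_iff_Suc_add by (metis not_le add_Suc_right)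
  have eq: "w ^ j * fls_deriv w / w ^ N = fls_deriv w * inverse w * inverse w ^ k"
    using assms by (simp add: N power_add field_simps)
  show ?thesis
  proof (cases k)
    case 0
    then show ?thesis using fls_residue_deriv_times_inverse_eq_subdegree(1)[of w] unfolding eq
      by (simp add: N)
  next
    case (Suc l)
    have "fls_deriv w * inverse w * inverse w ^ k = - (inverse w ^ l * fls_deriv (inverse w))"
      by (simp add: Suc fls_inverse_deriv power2_eq_square mult_ac)
    then show ?thesis unfolding eq using fls_residue_power_deriv[of "inverse w" l] Suc by (simp add: N)
  qed
qed

text \<open>Lagrange inversion: the coefficient is a residue in \<open>t\<close>, and since \<open>t = w / F^m\<close> with \<open>w = F - 1\<close>,
  its integrand is \<open>(1 + w)^(m*N-1) / w^N\<close> times the derivative of \<open>w\<close>.\<close>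
lemma log_deriv_euler_series_nth:
  assumes "m \<ge> 1" "N \<ge> 1"
  shows "log_deriv (rat_fps (euler_series m)) $ N = of_nat ((m * N - 1) choose (N - 1))"
proof -
  define F where "F = rat_fps (euler_series m)"
  define w where "w = F - 1"
  define W where "W = fps_to_fls w"
  define Fl where "Fl = fps_to_fls F"
  have F: "F = 1 + fps_X * F ^ m" unfolding F_def by (rule rat_euler_series_eq)
  have F0: "F $ 0 = 1" by (subst F) simp
  have w: "w = fps_X * F ^ m" unfolding w_def using F by (metis add_diff_cancel_left')
  \<comment> \<open>\<open>w\<close> has order exactly 1, so the residue of its logarithmic
    derivative is 1.\<close>
  have "w $ 1 = 1" using F0 by (simp add: w fps_power_zeroth)
  moreover have "w $ 0 = 0" by (simp add: w)
  ultimately have sub: "subdegree w = 1" by (intro subdegreeI) auto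
  then have subW: "fls_subdegree W = 1" by (simp add: W_def fls_subdegree_fls_to_fps)
  have Fl0: "Fl \<noteq> 0" and W0: "W \<noteq> 0" using F0 sub by (auto simp: Fl_def W_def)
  have FW: "Fl = W + 1" by (simp add: Fl_def W_def w_def)
  have WX: "W = fls_X * Fl ^ m"
    by (simp add: W_def w Fl_def fls_times_fps_to_fls fps_to_fls_power)
  have dF: "fps_to_fls (fps_deriv F) = fls_deriv W"
    by (simp add: W_def w_def fls_deriv_fps_to_fls)
  have "fls_X_intpow (- int N) * fls_X ^ N = (1 :: rat fls)"
    by (simp add: fls_X_power_conv_shift_1 fls_shifted_times_transfer)
  then have X: "fls_X_intpow (- int N) = 1 / (fls_X ^ N :: rat fls)"
    by (simp add: eq_divide_eq)
  obtain M where M: "m * N = Suc M" using assms by (cases "m * N") auto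
  have "log_deriv F $ N = (fps_deriv F * inverse F) $ (N - 1)"
    using assms by (simp add: log_deriv_def mult.assoc)
  also have "\<dots> = fls_nth (fps_to_fls (fps_deriv F * inverse F)) (int (N - 1))" by simp
  also have "\<dots> = fls_residue (fls_X_intpow (- int N) * fps_to_fls (fps_deriv F * inverse F))"
    using assms by (subst fls_residue_shift_nth) (simp add: of_nat_diff)
  also have "fps_to_fls (fps_deriv F * inverse F) = fls_deriv W / Fl"
    using F0 by (simp add: fls_times_fps_to_fls dF Fl_def divide_inverse fls_inverse_fps_to_fls)
  also have "fls_X_intpow (- int N) * (fls_deriv W / Fl) = Fl ^ M * fls_deriv W / W ^ N"
  proof -
    have "W ^ N = fls_X ^ N * (Fl * Fl ^ M)"
      by (simp only: WX power_mult_distrib M flip: power_mult power_Suc)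
    moreover have "1 / x * (y / Fl) = Fl ^ M * y / (x * (Fl * Fl ^ M))" for x y
      using Fl0 by (simp add: field_simps)
    ultimately show ?thesis by (simp only: X)
  qed
  \<comment> \<open>After expanding (W + 1)^M, only the term with j = N - 1 can have a nonzero
    residue.\<close>
  also have "\<dots> = (\<Sum>j\<le>M. of_int (int (M choose j)) * (W ^ j * fls_deriv W / W ^ N))"
    unfolding FW binomial_ring by (simp add: sum_distrib_right sum_divide_distrib mult.assoc)
  also have "fls_residue \<dots> = (\<Sum>j\<le>M. fls_residue (of_int (int (M choose j)) * (W ^ j * fls_deriv W / W ^ N)))"
    by (simp only: fls_residue_def fls_nth_sum)
  also have "\<dots> = (\<Sum>j\<le>M. of_nat (M choose j) * (if N = Suc j then 1 else 0))"
    unfolding fls_residue_of_int_times(1) fls_residue_power_times_deriv[OF W0]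
    by (simp only: subW of_int_1 of_int_of_nat_eq)
  also have "\<dots> = (\<Sum>j\<le>M. if j = N - 1 then of_nat (M choose j) else 0)"
    using assms by (intro sum.cong) auto
  also have "\<dots> = of_nat (M choose (N - 1))"
    by (auto simp: binomial_eq_0)
  finally show ?thesis by (simp add: F_def M)
qed

section \<open>Infinite products and divisor sums\<close>

lemma has_prod_one_minus_power_iff:
  fixes a :: "nat \<Rightarrow> rat" and G :: "rat fps"
  assumes G0: "G $ 0 = 1"
  shows "(\<lambda>i. one_minus_power (Suc i) (a (Suc i))) has_prod G \<longleftrightarrow>
    (\<forall>N\<ge>1. (\<Sum>n | n dvd N. - of_nat n * a n) = log_deriv G $ N)"
proof -
  define P where "P k = (\<Prod>i\<le>k. one_minus_power (Suc i) (a (Suc i)))" for k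
  have P0: "P k $ 0 = 1" for k by (induction k) (simp_all add: P_def)
  \<comment> \<open>A factor with n > N does not affect coefficient N, as n does not divide N; for k
    \<ge> N the partial product already gives the full divisor sum.\<close>
  have log_P: "log_deriv (P k) $ N = (\<Sum>n | n dvd N. - of_nat n * a n)" if N: "1 \<le> N" "N \<le> k" for k N
  proof -
    have "log_deriv (P k) $ N = (\<Sum>i\<le>k. log_deriv (one_minus_power (Suc i) (a (Suc i))) $ N)"
      unfolding P_def by (subst conjunct2[OF log_deriv_prod]) (simp_all add: fps_sum_nth)
    also have "\<dots> = (\<Sum>i\<le>k. if Suc i dvd N then - of_nat (Suc i) * a (Suc i) else 0)"
      using N by (intro sum.cong) (simp_all add: log_deriv_one_minus_power)
    also have "\<dots> = (\<Sum>i | i \<le> k \<and> Suc i dvd N. - of_nat (Suc i) * a (Suc i))"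
      by (simp add: sum.If_cases Int_def)
    also have "\<dots> = (\<Sum>n | n dvd N. - of_nat n * a n)"
      using N by (intro sum.reindex_bij_witness[of _ "\<lambda>n. n - 1" Suc])
        (auto dest: dvd_imp_le intro: Nat.gr0I)
    finally show ?thesis .
  qed
  \<comment> \<open>\<open>has_prod\<close> allows either a nonzero limit of the partial products or
    the value 0 caused by zero factors. As \<open>G\<close> is nonzero, plain convergence
    remains.\<close>
  have "(\<lambda>i. one_minus_power (Suc i) (a (Suc i))) has_prod G \<longleftrightarrow> P \<longlonglongrightarrow> G"
    using G0 by (auto simp: has_prod_def raw_has_prod_def P_def[abs_def])
  also have "\<dots> \<longleftrightarrow> (\<forall>N. eventually (\<lambda>k. P k $ N = G $ N) sequentially)"
    by (rule tendsto_fps_iff)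
  also have "\<dots> \<longleftrightarrow> (\<forall>N\<ge>1. (\<Sum>n | n dvd N. - of_nat n * a n) = log_deriv G $ N)"
  proof safe
    fix N :: nat
    assume lim: "\<forall>N. eventually (\<lambda>k. P k $ N = G $ N) sequentially" and N: "1 \<le> N"
    \<comment> \<open>\<open>log_deriv_nth_cong\<close> needs agreement in all coefficients up to N,
      so a single k has to serve all of them.\<close>
    have "eventually (\<lambda>k. \<forall>j\<in>{..N}. P k $ j = G $ j) sequentially"
      using lim by (simp add: eventually_ball_finite_distrib)
    with eventually_ge_at_top[of N] have "eventually (\<lambda>k. N \<le> k \<and> (\<forall>j\<in>{..N}. P k $ j = G $ j)) sequentially"
      by eventually_elim auto
    then obtain k where k: "N \<le> k" "\<forall>j\<in>{..N}. P k $ j = G $ j"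
      by (auto dest: eventually_happens)
    then have "log_deriv (P k) $ N = log_deriv G $ N"
      by (intro log_deriv_nth_cong) (auto simp: P0)
    then show "(\<Sum>n | n dvd N. - of_nat n * a n) = log_deriv G $ N"
      using log_P[OF N k(1)] by simp
  next
    fix N :: nat
    assume rel: "\<forall>N\<ge>1. (\<Sum>n | n dvd N. - of_nat n * a n) = log_deriv G $ N"
    have "P k $ N = G $ N" if "N \<le> k" for k
    proof (rule log_deriv_determines)
      fix j assume "j \<le> N"
      then show "log_deriv (P k) $ j = log_deriv G $ j"
        using that rel log_P[of j k] by (cases "j = 0") auto
    qed (simp_all add: P0 G0)
    then show "eventually (\<lambda>k. P k $ N = G $ N) sequentially"
      by (auto simp: eventually_sequentially)
  qed
  finally show ?thesis .
qed

text \<open>Strong induction: after the divisor N is split off, only proper divisors remain. This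
  takes the place of an explicit Moebius inversion.\<close>

lemma divisor_sum_inject:
  fixes f g :: "nat \<Rightarrow> 'a::cancel_comm_monoid_add"
  assumes "\<And>N. N \<ge> 1 \<Longrightarrow> (\<Sum>n | n dvd N. f n) = (\<Sum>n | n dvd N. g n)" "N \<ge> 1"
  shows "f N = g N"
  using assms(2)
proof (induction N rule: less_induct)
  case (less N)
  have fin: "finite {n. n dvd N}" using less by simp
  have "(\<Sum>n\<in>{n. n dvd N} - {N}. f n) = (\<Sum>n\<in>{n. n dvd N} - {N}. g n)"
  proof (intro sum.cong refl less.IH)
    fix n assume n: "n \<in> {n. n dvd N} - {N}"
    then show "n < N" using less.prems by (auto dest!: dvd_imp_le simp: order.not_eq_order_implies_strict)
    show "1 \<le> n" using n less.prems by (cases n) auto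
  qed
  then show ?case using assms(1)[OF less.prems] sum.remove[OF fin, of N f] sum.remove[OF fin, of N g] by simp
qed

text \<open>Reduces the definite description of \<open>DT\<close> to a divisor sum identity for a
  candidate \<open>D\<close>. One factor n comes from the exponent in the product and one from the
  logarithmic derivative of 1 - t^n, hence the square.\<close>

lemma DT_eqI:
  assumes m: "m \<ge> 1" and D0: "D 0 = 0"
    and D: "\<And>N. N \<ge> 1 \<Longrightarrow> (\<Sum>n | n dvd N. (- 1) ^ ((m - 1) * n) * of_nat (n\<^sup>2) * D n) =
        (- 1) ^ ((m - 1) * N) * of_nat ((m * N - 1) choose (N - 1))"
  shows "DT m = D"
proof -
  define c :: rat where "c = (- 1) ^ (m - 1)"
  define F where "F = rat_fps (euler_series m)"
  define G where "G = F oo (fps_const c * fps_X)"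
  have F0: "F $ 0 = 1" unfolding F_def by (subst rat_euler_series_eq) simp
  have G0: "G $ 0 = 1" by (simp add: G_def F0)
  have log_G: "log_deriv G $ N = (- 1) ^ ((m - 1) * N) * of_nat ((m * N - 1) choose (N - 1))"
    if "N \<ge> 1" for N
  proof -
    have "log_deriv G = log_deriv F oo (fps_const c * fps_X)"
      unfolding G_def using log_deriv_compose[of F "fps_const c * fps_X" 1] F0
      by (simp add: mult.commute)
    then show ?thesis
      using log_deriv_euler_series_nth[OF m that] by (simp add: fps_compose_linear F_def c_def power_mult)
  qed
  have iff: "(\<lambda>i. let n = Suc i in one_minus_power n (- ((- 1) ^ ((m - 1) * n) * of_nat n * E n))) has_prod
       (Abs_fps (\<lambda>k. of_int (fps_nth (euler_series m) k)) oo (fps_const ((- 1) ^ (m - 1)) * fps_X)) \<longleftrightarrow>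
     (\<forall>N\<ge>1. (\<Sum>n | n dvd N. (- 1) ^ ((m - 1) * n) * of_nat (n\<^sup>2) * E n) =
        (- 1) ^ ((m - 1) * N) * of_nat ((m * N - 1) choose (N - 1)))" for E :: "nat \<Rightarrow> rat"
    using has_prod_one_minus_power_iff[OF G0, of "\<lambda>n. - ((- 1) ^ ((m - 1) * n) * of_nat n * E n)"] log_G
    by (simp add: Let_def G_def F_def rat_fps_def c_def power2_eq_square mult_ac)
  show ?thesis
    unfolding DT_def iff
  proof (rule the_equality)
    fix E :: "nat \<Rightarrow> rat"
    assume E: "E 0 = 0 \<and> (\<forall>N\<ge>1. (\<Sum>n | n dvd N. (- 1) ^ ((m - 1) * n) * of_nat (n\<^sup>2) * E n) =
        (- 1) ^ ((m - 1) * N) * of_nat ((m * N - 1) choose (N - 1)))"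
    show "E = D"
    proof
      fix n
      show "E n = D n"
      proof (cases "n = 0")
        case False
        then have "(- 1) ^ ((m - 1) * n) * of_nat (n\<^sup>2) * E n = (- 1) ^ ((m - 1) * n) * of_nat (n\<^sup>2) * D n"
          using E D by (intro divisor_sum_inject[of "\<lambda>n. (- 1) ^ ((m - 1) * n) * of_nat (n\<^sup>2) * E n"]) auto
        then show ?thesis using False by simp
      qed (use E D0 in simp)
    qed
  qed (use D0 D in simp)
qed

section \<open>The cycle lemma\<close>

text \<open>Adding the wrap-around step to condition (1) and dropping condition (3) gives a set
  closed under rotation.\<close>

definition cyclic_seqs :: "nat \<Rightarrow> nat \<Rightarrow> int \<Rightarrow> int list set" where
  "cyclic_seqs m n d = {l. length l = n \<and>
     (\<forall>k<n. l ! (Suc k mod n) - l ! k + (int m - 1) \<ge> 0) \<and> (\<Sum>i<n. l ! i) = d}"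

text \<open>This is n times the excess of the partial sums over the line of slope d/n, so it stays
  in the integers. Reading the list modulo n continues it past the end, which makes rotations
  comparable.\<close>

definition height :: "nat \<Rightarrow> int \<Rightarrow> int list \<Rightarrow> nat \<Rightarrow> int" where
  "height n d l k = (\<Sum>i<k. int n * l ! (i mod n) - d)"

lemma height_add:
  assumes "length l = n" "(\<Sum>i<n. l ! i) = d"
  shows "height n d l (n + k) = height n d l k"
proof -
  have "height n d l n = 0"
    using assms by (simp add: height_def sum_subtractf flip: sum_distrib_left)
  moreover have "height n d l (n + k) = height n d l n + height n d l k"
    by (induction k) (simp_all add: height_def)
  ultimately show ?thesis by simp
qed

lemma height_rotate:
  assumes "length l = n" "n > 0"
  shows "height n d (rotate r l) k = height n d l (r + k) - height n d l r"
  using assms by (induction k) (simp_all add: height_def nth_rotate mod_add_right_eq)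

lemma rotate_cyclic_seqs:
  assumes "n > 0" "l \<in> cyclic_seqs m n d"
  shows "rotate r l \<in> cyclic_seqs m n d"
proof -
  have l: "length l = n" "\<And>k. k < n \<Longrightarrow> l ! (Suc k mod n) - l ! k + (int m - 1) \<ge> 0" "(\<Sum>i<n. l ! i) = d"
    using assms by (auto simp: cyclic_seqs_def)
  have "rotate r l ! (Suc k mod n) - rotate r l ! k + (int m - 1) \<ge> 0" if "k < n" for k
    using that l(1) l(2)[of "(r + k) mod n"] assms(1)
    by (simp add: nth_rotate mod_add_right_eq mod_Suc_eq)
  moreover have "(\<Sum>i<n. rotate r l ! i) = d"
  proof -
    have "(\<Sum>i<n. xs ! i) = sum_list xs" if "length xs = n" for xs :: "int list"
      using that by (simp add: sum_list_sum_nth atLeast0LessThan)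
    moreover have "sum_list (rotate r l) = sum_list l"
      by (metis add.commute append_take_drop_id rotate_drop_take sum_list.append)
    ultimately show ?thesis using l by simp
  qed
  ultimately show ?thesis using l by (simp add: cyclic_seqs_def)
qed

lemma H_set_iff_height:
  assumes "m \<ge> 1" "n > 0"
  shows "l \<in> H_set m n d \<longleftrightarrow> l \<in> cyclic_seqs m n d \<and> (\<forall>k<n. height n d l k \<ge> 0)"
proof -
  have slope: "1 / rat_of_nat k * (\<Sum>i<k. rat_of_int (l ! i)) \<ge> rat_of_int d / rat_of_nat n \<longleftrightarrow>
      height n d l k \<ge> 0" if "1 \<le> k" "k < n" for k
  proof -
    have "height n d l k = int n * (\<Sum>i<k. l ! i) - int k * d"
      using that by (simp add: height_def sum_subtractf flip: sum_distrib_left)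
    moreover have "1 / rat_of_nat k * (\<Sum>i<k. rat_of_int (l ! i)) \<ge> rat_of_int d / rat_of_nat n \<longleftrightarrow>
        rat_of_int (int n * (\<Sum>i<k. l ! i)) \<ge> rat_of_int (int k * d)"
      using that by (simp add: field_simps)
    ultimately show ?thesis unfolding of_int_le_iff by simp
  qed
  have slopes: "(\<forall>k. 1 \<le> k \<and> k < n \<longrightarrow>
         1 / rat_of_nat k * (\<Sum>i<k. rat_of_int (l ! i)) \<ge> rat_of_int d / rat_of_nat n) \<longleftrightarrow>
      (\<forall>k<n. height n d l k \<ge> 0)"
    using slope by (auto simp: height_def Suc_le_eq) (metis gr0I lessThan_0 order_refl sum.empty)
  have steps: "(\<forall>k<n. l ! (Suc k mod n) - l ! k + (int m - 1) \<ge> 0) \<longleftrightarrow>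
      (\<forall>k. 1 \<le> k \<and> k \<le> n - 1 \<longrightarrow> l ! k - l ! (k - 1) + (int m - 1) \<ge> 0)"
    if len: "length l = n" and sum: "(\<Sum>i<n. l ! i) = d" and ht: "\<forall>k<n. height n d l k \<ge> 0"
  proof safe
    fix k assume *: "\<forall>k<n. l ! (Suc k mod n) - l ! k + (int m - 1) \<ge> 0" "1 \<le> k" "k \<le> n - 1"
    then show "l ! k - l ! (k - 1) + (int m - 1) \<ge> 0"
      using *(1)[rule_format, of "k - 1"] by auto
  next
    fix k assume *: "\<forall>k. 1 \<le> k \<and> k \<le> n - 1 \<longrightarrow> l ! k - l ! (k - 1) + (int m - 1) \<ge> 0" "k < n"
    show "l ! (Suc k mod n) - l ! k + (int m - 1) \<ge> 0"
    proof (cases "Suc k < n")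
      case True
      then show ?thesis using *(1)[rule_format, of "Suc k"] by auto
    next
      case False
      then have n: "n = Suc k" using *(2) by simp
      \<comment> \<open>Here k = n - 1. Nonnegative heights at 1 and at n - 1 give l_1 \<ge> d/n
        \<ge> l_n, the latter because the height at n is 0.\<close>
      have "l ! 0 \<ge> l ! k"
      proof (cases "k = 0")
        case False
        have "height n d l 1 \<ge> 0" using ht False n by simp
        then have "int n * l ! 0 \<ge> d" by (simp add: height_def)
        moreover have "height n d l n = height n d l k + (int n * l ! k - d)"
          by (simp add: height_def n)
        then have "height n d l k = d - int n * l ! k"
          using height_add[OF len sum, of 0] by (simp add: height_def)
        then have "d \<ge> int n * l ! k" using ht n by (metis diff_ge_0_iff_ge lessI)
        ultimately show ?thesis using assms(2) by (meson mult_le_cancel_left_pos of_nat_0_less_iff order_trans)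
      qed simp
      then show ?thesis using n assms(1) by simp
    qed
  qed
  show ?thesis
    unfolding H_set_def cyclic_seqs_def mem_Collect_eq slopes using steps by blast
qed

text \<open>Modulo n the height at k is -k d, and d is invertible modulo n.\<close>

lemma inj_on_height:
  assumes "coprime d (int n)"
  shows "inj_on (height n d l) {..<n}"
proof (rule inj_onI)
  fix i j assume ij: "i \<in> {..<n}" "j \<in> {..<n}" and eq: "height n d l i = height n d l j"
  have "height n d l k = int n * (\<Sum>i<k. l ! (i mod n)) - int k * d" for k
    by (simp add: height_def sum_subtractf flip: sum_distrib_left)
  with eq have "d * (int i - int j) = int n * ((\<Sum>i<i. l ! (i mod n)) - (\<Sum>i<j. l ! (i mod n)))"
    by (simp add: algebra_simps)
  then have "int n dvd d * (int i - int j)" by simp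
  then have "int n dvd int i - int j"
    using assms by (simp add: coprime_dvd_mult_right_iff coprime_commute)
  then have "int i mod int n = int j mod int n" by (simp add: mod_eq_dvd_iff)
  then show "i = j" using ij by simp
qed

text \<open>Rotating by r subtracts the height at r, so nonnegativity makes r a minimum over the
  window from r to r + n - 1. By periodicity this window can be replaced by that from 0 to n -
  1.\<close>

lemma rotate_in_H_set_iff:
  assumes "m \<ge> 1" "n > 0" "l \<in> cyclic_seqs m n d" "r < n"
  shows "rotate r l \<in> H_set m n d \<longleftrightarrow> (\<forall>j<n. height n d l r \<le> height n d l j)"
proof -
  have l: "length l = n" "(\<Sum>i<n. l ! i) = d" using assms by (auto simp: cyclic_seqs_def)
  have "rotate r l \<in> H_set m n d \<longleftrightarrow> (\<forall>k<n. height n d l r \<le> height n d l (r + k))"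
    using assms l by (simp add: H_set_iff_height rotate_cyclic_seqs height_rotate)
  also have "\<dots> \<longleftrightarrow> (\<forall>j<n. height n d l r \<le> height n d l j)"
  proof safe
    fix j assume *: "\<forall>k<n. height n d l r \<le> height n d l (r + k)" "j < n"
    show "height n d l r \<le> height n d l j"
    proof (cases "r \<le> j")
      case True
      then show ?thesis using *(1)[rule_format, of "j - r"] *(2) by auto
    next
      case False
      then show ?thesis using *(1)[rule_format, of "n + j - r"] assms(4) height_add[OF l, of j] by auto
    qed
  next
    fix k assume *: "\<forall>j<n. height n d l r \<le> height n d l j" "k < n"
    show "height n d l r \<le> height n d l (r + k)"
    proof (cases "r + k < n")
      case False
      then show ?thesis using * assms(4) height_add[OF l, of "r + k - n"] by simp
    qed (use * in simp)
  qed
  finally show ?thesis .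
qed

text \<open>Cycle lemma: the rotation that lies in \<open>H_set\<close> starts at the minimum of the height, which is
  attained only once per period because \<open>d\<close> is coprime to \<open>n\<close>.\<close>
lemma bij_betw_H_set_cyclic_seqs:
  assumes "m \<ge> 1" "n > 0" "coprime d (int n)"
  shows "bij_betw (\<lambda>(h, r). rotate (n - r) h) (H_set m n d \<times> {..<n}) (cyclic_seqs m n d)"
proof -
  have H: "h \<in> cyclic_seqs m n d" "length h = n" if "h \<in> H_set m n d" for h
    using that H_set_iff_height[OF assms(1,2)] by (auto simp: cyclic_seqs_def)
  have inv1: "rotate r (rotate (n - r) h) = h" and inv2: "rotate (n - r) (rotate r h) = h"
    if "r < n" "length h = n" for h :: "int list" and r
    using that by (simp_all add: rotate_rotate)
  have inj: "r = r'" "h = h'" if "h \<in> H_set m n d" "r < n" "h' \<in> H_set m n d" "r' < n"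
      "rotate (n - r) h = rotate (n - r') h'" for h r h' r'
  proof -
    define l where "l = rotate (n - r) h"
    have lc: "l \<in> cyclic_seqs m n d" using H that assms by (simp add: l_def rotate_cyclic_seqs)
    have hl: "h = rotate r l" "h' = rotate r' l" using that inv1 H by (simp_all add: l_def, metis)
    \<comment> \<open>Both r and r' minimize the height of \<open>l\<close>.\<close>
    have "height n d l r = height n d l r'"
      using that rotate_in_H_set_iff[OF assms(1,2) lc] hl by (intro antisym) auto
    then show "r = r'" using inj_on_height[OF assms(3), of l] that by (auto dest: inj_onD)
    then show "h = h'" using hl by simp
  qed
  have surj: "\<exists>h r. h \<in> H_set m n d \<and> r < n \<and> l = rotate (n - r) h" if l: "l \<in> cyclic_seqs m n d" for l
  proof -
    have fin: "finite (height n d l ` {..<n})" "height n d l ` {..<n} \<noteq> {}" using assms(2) by auto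
    obtain r where r: "r < n" "height n d l r = Min (height n d l ` {..<n})"
      using Min_in[OF fin] by auto
    have "\<forall>j<n. height n d l r \<le> height n d l j" using fin r by simp
    then have "rotate r l \<in> H_set m n d" using rotate_in_H_set_iff[OF assms(1,2) l r(1)] by simp
    moreover have "l = rotate (n - r) (rotate r l)"
      using inv2 r l by (simp add: cyclic_seqs_def)
    ultimately show ?thesis using r by blast
  qed
  show ?thesis unfolding bij_betw_def
  proof
    show "inj_on (\<lambda>(h, r). rotate (n - r) h) (H_set m n d \<times> {..<n})"
      by (rule inj_onI) (clarsimp, metis inj)
    show "(\<lambda>(h, r). rotate (n - r) h) ` (H_set m n d \<times> {..<n}) = cyclic_seqs m n d"
      using surj H assms by (fastforce simp: rotate_cyclic_seqs)
  qed
qed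

section \<open>Cyclic sequences and their shifted differences\<close>

definition step_seqs :: "nat \<Rightarrow> nat \<Rightarrow> int \<Rightarrow> nat list set" where
  "step_seqs m n d = {a \<in> natpermute (n * (m - 1)) n.
     int n dvd int (\<Sum>j<n. j * a ! j) + d - (int m - 1) * int (\<Sum>j<n. j)}"

lemma weighted_telescope:
  fixes x :: "nat \<Rightarrow> int"
  shows "(\<Sum>j<n. int j * (x (Suc j) - x j)) = int n * x n - (\<Sum>j<n. x (Suc j))"
  by (induction n) (simp_all add: algebra_simps)

lemma weighted_telescope_periodic:
  fixes x :: "nat \<Rightarrow> int"
  assumes "x n = x 0"
  shows "(\<Sum>j<n. int j * (x (Suc j) - x j)) = int n * x 0 - (\<Sum>j<n. x j)"
proof -
  have "(\<Sum>j<n. x (Suc j)) = (\<Sum>j<n. x j)"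
    using sum.lessThan_Suc_shift[of x n] assms by simp
  then show ?thesis using assms by (simp add: weighted_telescope)
qed

lemma sum_list_eq_sum_lessThan: "length a = n \<Longrightarrow> sum_list a = (\<Sum>j<n. a ! j)"
  by (simp add: sum_list_sum_nth atLeast0LessThan)

text \<open>Differences forget only the initial value l_1. Summation by parts, in
  \<open>weight\<close>, recovers n l_1 from the differences and d; the congruence in
  \<open>step_seqs\<close> says that the resulting l_1 is an integer.\<close>

lemma bij_betw_cyclic_seqs_step_seqs:
  assumes m: "m \<ge> 1" and n: "n > 0"
  shows "bij_betw (\<lambda>l. map (\<lambda>k. nat (l ! (Suc k mod n) - l ! k + (int m - 1))) [0..<n])
    (cyclic_seqs m n d) (step_seqs m n d)"
    (is "bij_betw ?f _ _")
proof -
  have weight: "int (\<Sum>j<n. j * ?f l ! j) = int n * l ! 0 - d + (int m - 1) * int (\<Sum>j<n. j)"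
    if l: "l \<in> cyclic_seqs m n d" for l
  proof -
    have "int (\<Sum>j<n. j * ?f l ! j) = (\<Sum>j<n. int j * (l ! (Suc j mod n) - l ! (j mod n)) + (int m - 1) * int j)"
      using l unfolding of_nat_sum by (intro sum.cong) (auto simp: cyclic_seqs_def algebra_simps)
    also have "\<dots> = (\<Sum>j<n. int j * (l ! (Suc j mod n) - l ! (j mod n))) + (int m - 1) * int (\<Sum>j<n. j)"
      by (simp add: sum.distrib sum_distrib_left)
    also have "(\<Sum>j<n. int j * (l ! (Suc j mod n) - l ! (j mod n))) = int n * l ! 0 - d"
      using weighted_telescope_periodic[of "\<lambda>j. l ! (j mod n)" n] l by (simp add: cyclic_seqs_def)
    finally show ?thesis .
  qed
  have f_in: "?f l \<in> step_seqs m n d" if l: "l \<in> cyclic_seqs m n d" for l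
  proof -
    have "int (\<Sum>j<n. ?f l ! j) = (\<Sum>j<n. (l ! (Suc j mod n) - l ! (j mod n)) + (int m - 1))"
      using l unfolding of_nat_sum by (intro sum.cong) (auto simp: cyclic_seqs_def)
    also have "\<dots> = int n * (int m - 1)"
      using sum_lessThan_telescope[of "\<lambda>j. l ! (j mod n)" n] by (simp add: sum.distrib)
    also have "\<dots> = int (n * (m - 1))" using m by (simp add: of_nat_diff)
    finally have "sum_list (?f l) = n * (m - 1)"
      by (subst sum_list_eq_sum_lessThan[where n = n]) (simp, linarith)
    then have "?f l \<in> natpermute (n * (m - 1)) n" by (simp add: natpermute_def)
    then show ?thesis unfolding step_seqs_def mem_Collect_eq weight[OF l] by simp
  qed
  have inj: "l = l'" if l: "l \<in> cyclic_seqs m n d" "l' \<in> cyclic_seqs m n d" and eq: "?f l = ?f l'" for l l'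
  proof -
    have "int n * l ! 0 = int n * l' ! 0" using weight[OF l(1)] weight[OF l(2)] eq by simp
    then have l0: "l ! 0 = l' ! 0" using n by simp
    have step: "l ! (Suc k mod n) - l ! k = l' ! (Suc k mod n) - l' ! k" if "k < n" for k
    proof -
      have "?f l ! k = ?f l' ! k" by (simp only: eq)
      moreover have "l ! (Suc k mod n) - l ! k + (int m - 1) \<ge> 0" "l' ! (Suc k mod n) - l' ! k + (int m - 1) \<ge> 0"
        using l that by (simp_all add: cyclic_seqs_def)
      ultimately show ?thesis using that by simp
    qed
    have "k < n \<Longrightarrow> l ! k = l' ! k" for k
    proof (induction k)
      case (Suc k)
      then show ?case using step[of k] by simp
    qed (use l0 in simp)
    then show ?thesis using l by (intro nth_equalityI) (auto simp: cyclic_seqs_def)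
  qed
  have surj: "\<exists>l\<in>cyclic_seqs m n d. a = ?f l" if a: "a \<in> step_seqs m n d" for a
  proof -
    \<comment> \<open>The initial value of the sequence to be built, solved from
      \<open>weight\<close>.\<close>
    define q where "q = (int (\<Sum>j<n. j * a ! j) + d - (int m - 1) * int (\<Sum>j<n. j)) div int n"
    have q: "int n * q = int (\<Sum>j<n. j * a ! j) + d - (int m - 1) * int (\<Sum>j<n. j)"
      using a by (simp add: q_def step_seqs_def)
    have len: "length a = n" using a by (simp add: step_seqs_def natpermute_def)
    define X where "X k = q + (\<Sum>j<k. int (a ! j) - (int m - 1))" for k
    define l where "l = map X [0..<n]"
    have "int (\<Sum>j<n. a ! j) = int n * (int m - 1)"
      using a m len by (simp add: step_seqs_def natpermute_def sum_list_eq_sum_lessThan[where n = n] of_nat_diff del: of_nat_sum)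
    then have Xn: "X n = X 0" by (simp add: X_def sum_subtractf)
    have lX: "l ! (Suc k mod n) = X (Suc k)" "l ! k = X k" if "k < n" for k
    proof -
      show "l ! (Suc k mod n) = X (Suc k)"
        using that Xn by (cases "Suc k = n") (auto simp: l_def)
    qed (use that in \<open>simp add: l_def\<close>)
    have "(\<Sum>j<n. int j * (X (Suc j) - X j)) = int (\<Sum>j<n. j * a ! j) - (int m - 1) * int (\<Sum>j<n. j)"
      by (simp add: X_def algebra_simps sum_subtractf sum.distrib sum_distrib_left)
    then have "(\<Sum>j<n. X j) = d"
      using weighted_telescope_periodic[OF Xn] q by (simp add: X_def)
    then have "l \<in> cyclic_seqs m n d" using lX by (simp add: cyclic_seqs_def l_def X_def)
    moreover have "a = ?f l"
      using len lX by (intro nth_equalityI) (simp_all add: X_def)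
    ultimately show ?thesis by blast
  qed
  show ?thesis unfolding bij_betw_def
  proof
    show "inj_on ?f (cyclic_seqs m n d)" by (rule inj_onI) (rule inj)
    show "?f ` cyclic_seqs m n d = step_seqs m n d"
      using f_in surj by (blast intro: image_eqI)
  qed
qed

lemma H_set_card:
  assumes "m \<ge> 1" "n > 0" "coprime d (int n)"
  shows "finite (H_set m n d)" "n * card (H_set m n d) = card (step_seqs m n d)"
proof -
  have fin: "finite (step_seqs m n d)" by (simp add: step_seqs_def natpermute_finite)
  note b1 = bij_betw_H_set_cyclic_seqs[OF assms]
  note b2 = bij_betw_cyclic_seqs_step_seqs[OF assms(1,2), of d]
  have "finite (H_set m n d \<times> {..<n})"
    using fin bij_betw_finite[OF b1] bij_betw_finite[OF b2] by simp
  then show "finite (H_set m n d)" using assms(2) by (auto simp: finite_cartesian_product_iff)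
  show "n * card (H_set m n d) = card (step_seqs m n d)"
    using bij_betw_same_card[OF b1] bij_betw_same_card[OF b2] by (simp add: card_cartesian_product mult.commute)
qed

section \<open>Counting with roots of unity\<close>

text \<open>The power \<zeta>^k of \<zeta> = e^(2 pi i / n), with negative exponents
  allowed.\<close>

definition root_exp :: "nat \<Rightarrow> int \<Rightarrow> complex" where
  "root_exp n k = cis (2 * pi * of_int k / of_nat n)"

lemma root_exp_0 [simp]: "root_exp n 0 = 1"
  by (simp add: root_exp_def)

lemma root_exp_add: "root_exp n (j + k) = root_exp n j * root_exp n k"
  by (simp add: root_exp_def cis_mult ring_distribs add_divide_distrib)

lemma root_exp_power: "root_exp n k ^ j = root_exp n (int j * k)"
  by (simp add: root_exp_def Complex.DeMoivre mult_ac)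

lemma root_exp_sum: "root_exp n (\<Sum>i\<in>A. f i) = (\<Prod>i\<in>A. root_exp n (f i))"
  by (induction A rule: infinite_finite_induct) (simp_all add: root_exp_add)

lemma root_exp_eq_1_iff:
  assumes "n > 0"
  shows "root_exp n k = 1 \<longleftrightarrow> int n dvd k"
proof
  assume "root_exp n k = 1"
  then have "cos (2 * pi * of_int k / of_nat n) = 1"
    by (simp add: root_exp_def cis.ctr complex_eq_iff)
  then obtain j :: int where "2 * pi * of_int k / of_nat n = of_int j * 2 * pi"
    using cos_one_2pi_int by metis
  then have "real_of_int k = real_of_int (j * int n)"
    using assms by (simp add: field_simps)
  then have "k = j * int n" unfolding of_int_eq_iff .
  then show "int n dvd k" by simp
next
  assume "int n dvd k"
  then obtain j where "k = int n * j" by (auto elim: dvdE)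
  then have "2 * pi * of_int k / of_nat n = 2 * pi * of_int j" using assms by simp
  then show "root_exp n k = 1" by (simp add: root_exp_def)
qed

lemma root_exp_cong:
  assumes "n > 0" "int n dvd j - k"
  shows "root_exp n j = root_exp n k"
  using root_exp_add[of n "j - k" k] root_exp_eq_1_iff[OF assms(1)] assms(2) by simp

lemma sum_root_exp:
  assumes "n > 0"
  shows "(\<Sum>s<n. root_exp n (int s * k)) = (if int n dvd k then of_nat n else 0)"
proof (cases "int n dvd k")
  case True
  then have "root_exp n (int s * k) = 1" for s
    using assms by (simp add: root_exp_eq_1_iff)
  then show ?thesis using True by simp
next
  case False
  then have "root_exp n k \<noteq> 1" using assms by (simp add: root_exp_eq_1_iff)
  moreover have "root_exp n k ^ n = 1" using assms by (simp add: root_exp_power root_exp_eq_1_iff)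
  moreover have "(\<Sum>s<n. root_exp n (int s * k)) = (\<Sum>s<n. root_exp n k ^ s)"
    by (simp add: root_exp_power)
  ultimately show ?thesis using False geometric_sum[of "root_exp n k" n] by simp
qed

text \<open>Each factor on the right is a geometric series in z_j t, and
  \<open>natpermute M n\<close> lists the ways to choose exponents adding up to M.\<close>

lemma sum_natpermute_prod_power:
  fixes z :: "nat \<Rightarrow> 'a::field_char_0"
  assumes "n > 0"
  shows "(\<Sum>a\<in>natpermute M n. \<Prod>j<n. z j ^ (a ! j)) =
    (\<Prod>j<n. inverse (1 - fps_const (z j) * fps_X)) $ M"
proof -
  obtain k where n: "n = Suc k" using assms gr0_implies_Suc by blast
  have "inverse (1 - fps_const c * fps_X) $ i = c ^ i" for c :: 'a and i
    using one_minus_const_fps_X_neg_power'[of 1 c] by simp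
  then show ?thesis
    using fps_prod_nth[of "\<lambda>j. inverse (1 - fps_const (z j) * fps_X)" k M]
    by (simp add: n atLeast0AtMost lessThan_Suc_atMost)
qed

text \<open>With g = gcd s n and e = n / g, the numbers \<zeta>^(s j) run g times through the e-th
  roots of unity, so the product is (1 - t^e)^(-g). In the logarithmic derivatives this becomes a
  statement about power sums of roots of unity.\<close>

lemma prod_inverse_one_minus_root_exp:
  assumes n: "n > 0"
  shows "(\<Prod>j<n. inverse (1 - fps_const (root_exp n (int s * int j)) * fps_X)) =
    inverse ((1 - fps_X) ^ gcd s n) oo fps_X ^ (n div gcd s n)"
    (is "?L = ?R oo _")
proof (rule log_deriv_eq_imp_eq)
  define g where "g = gcd s n"
  define e where "e = n div g"
  have g: "g > 0" and e: "e > 0" and ge: "n = g * e"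
    using n by (auto simp: g_def e_def div_greater_zero_iff gcd_le2_nat)
  have ne: "(of_nat n :: complex) = of_nat e * of_nat g" by (subst ge) simp
  have dvd_iff: "int n dvd int s * int N \<longleftrightarrow> e dvd N" for N
  proof -
    have "s = g * (s div g)" by (simp add: g_def)
    moreover have "coprime (s div g) e"
      unfolding g_def e_def using n by (intro div_gcd_coprime) auto
    ultimately show ?thesis
      using g ge by (metis coprime_commute coprime_dvd_mult_right_iff mult.assoc nat_mult_dvd_cancel_disj
          not_gr0 of_nat_dvd_iff of_nat_mult)
  qed
  show L0: "?L $ 0 \<noteq> 0" "?L $ 0 = (?R oo fps_X ^ (n div gcd s n)) $ 0"
    by (simp_all add: fps_prod_nth_0 fps_power_zeroth)
  have R: "log_deriv ?R $ N = (if N = 0 then 0 else of_nat g)" for N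
    using log_deriv_inverse_one_minus_const_X[of "1::complex" N]
    by (simp add: fps_inverse_power log_deriv_power g_def flip: fps_of_nat)
  have "log_deriv ?L $ N = log_deriv (?R oo fps_X ^ e) $ N" for N
  proof -
    have "log_deriv ?L $ N = (\<Sum>j<n. if N = 0 then 0 else root_exp n (int s * int j) ^ N)"
      by (subst conjunct2[OF log_deriv_prod])
        (simp_all add: fps_sum_nth log_deriv_inverse_one_minus_const_X)
    also have "\<dots> = (if N = 0 then 0 else (\<Sum>j<n. root_exp n (int j * (int s * int N))))"
      by (simp add: root_exp_power mult_ac)
    also have "\<dots> = (if N \<noteq> 0 \<and> e dvd N then of_nat n else 0)"
      using sum_root_exp[OF n] dvd_iff by simp
    also have "\<dots> = of_nat e * (log_deriv ?R oo fps_X ^ e) $ N"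
      using e ne by (simp add: fps_compose_X_power_nth R dvd_div_eq_0_iff)
    also have "\<dots> = log_deriv (?R oo fps_X ^ e) $ N"
      using e by (subst log_deriv_compose[of _ _ e])
        (simp_all add: fps_X_deriv_X_power fps_power_zeroth flip: fps_of_nat)
    finally show ?thesis .
  qed
  then show "log_deriv ?L = log_deriv (?R oo fps_X ^ (n div gcd s n))"
    by (simp add: fps_eq_iff e_def g_def)
qed

text \<open>Roots of unity filter: n times the indicator of the congruence is a sum of powers of
  \<zeta> over s, and exchanging the sums leaves one generating function for each s.\<close>

lemma card_step_seqs:
  assumes m: "m \<ge> 1" and n: "n > 0"
  shows "of_nat n * of_nat (card (step_seqs m n d)) =
    (\<Sum>s<n. root_exp n (int s * (d - (int m - 1) * int (\<Sum>j<n. j))) *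
      of_nat ((m * gcd s n - 1) choose (gcd s n - 1)))"
proof -
  define c where "c = d - (int m - 1) * int (\<Sum>j<n. j)"
  define P where "P = natpermute (n * (m - 1)) n"
  have fin: "finite P" by (simp add: P_def natpermute_finite)
  have step: "step_seqs m n d = {a \<in> P. int n dvd int (\<Sum>j<n. j * a ! j) + c}"
    by (simp add: step_seqs_def P_def c_def algebra_simps)
  \<comment> \<open>The coefficient of t^(n (m - 1)) in (1 - t^e)^(-g) is that of t^(g (m - 1)) in
    (1 - t)^(-g). For s = 0 the gcd is n.\<close>
  have coeff: "(\<Sum>a\<in>P. root_exp n (int s * int (\<Sum>j<n. j * a ! j))) =
      of_nat ((m * gcd s n - 1) choose (gcd s n - 1))" for s
  proof -
    define g where "g = gcd s n"
    define e where "e = n div g"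
    have g: "g > 0" and e: "e > 0" and ge: "n = g * e"
      using n by (auto simp: g_def e_def div_greater_zero_iff gcd_le2_nat)
    have "(\<Sum>a\<in>P. root_exp n (int s * int (\<Sum>j<n. j * a ! j))) =
        (\<Sum>a\<in>P. \<Prod>j<n. root_exp n (int s * int j) ^ (a ! j))"
      by (simp add: root_exp_power root_exp_sum sum_distrib_left mult_ac)
    also have "\<dots> = (inverse ((1 - fps_X) ^ g) oo fps_X ^ e) $ (n * (m - 1))"
      unfolding P_def sum_natpermute_prod_power[OF n] prod_inverse_one_minus_root_exp[OF n]
      by (simp add: g_def e_def)
    also have "\<dots> = inverse ((1 - fps_X) ^ g) $ (g * (m - 1))"
      using e by (simp add: fps_compose_X_power_nth ge mult.assoc mult.left_commute)
    also have "\<dots> = of_nat ((g + g * (m - 1) - 1) choose (g * (m - 1)))"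
      using one_minus_const_fps_X_neg_power'[OF g, of "1::complex"] by simp
    also have "g + g * (m - 1) = m * g" using m by (cases m) simp_all
    also have "(m * g - 1) choose (g * (m - 1)) = (m * g - 1) choose (g - 1)"
    proof -
      have "m * g - 1 = g * (m - 1) + (g - 1)" using m g by (cases m) (simp_all add: algebra_simps)
      then show ?thesis by (metis add.commute add_diff_cancel_left' binomial_symmetric le_add1)
    qed
    finally show ?thesis by (simp add: g_def)
  qed
  have "of_nat n * of_nat (card (step_seqs m n d)) =
      (\<Sum>a\<in>P. if int n dvd int (\<Sum>j<n. j * a ! j) + c then (of_nat n :: complex) else 0)"
    using fin by (simp add: step sum.If_cases Int_def conj_commute mult.commute)
  also have "\<dots> = (\<Sum>a\<in>P. \<Sum>s<n. root_exp n (int s * (int (\<Sum>j<n. j * a ! j) + c)))"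
    by (simp only: sum_root_exp[OF n])
  also have "\<dots> = (\<Sum>s<n. \<Sum>a\<in>P. root_exp n (int s * (int (\<Sum>j<n. j * a ! j) + c)))"
    by (rule sum.swap)
  also have "\<dots> = (\<Sum>s<n. root_exp n (int s * c) * (\<Sum>a\<in>P. root_exp n (int s * int (\<Sum>j<n. j * a ! j))))"
    by (simp only: distrib_left root_exp_add sum_distrib_left mult.commute)
  finally show ?thesis unfolding coeff c_def .
qed

section \<open>Signs, independence of d and summation over divisors\<close>

definition signed_binomial :: "nat \<Rightarrow> nat \<Rightarrow> int" where
  "signed_binomial m g = (- 1) ^ ((m - 1) * g) * int ((m * g - 1) choose (g - 1))"

text \<open>The exponent is n (n - 1) / 2, so the value is e^(pi i (n - 1)).\<close>

lemma root_exp_triangular: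
  assumes n: "n > 0"
  shows "root_exp n (int (\<Sum>j<n. j)) = (- 1) ^ (n - 1)"
proof -
  have "2 * (\<Sum>j<n. j) = n * (n - 1)"
  proof (induction n)
    case (Suc n)
    then show ?case by (cases n) simp_all
  qed simp
  then have "2 * real (\<Sum>j<n. j) = real n * real (n - 1)"
    by (metis of_nat_mult of_nat_numeral)
  then have "pi * (2 * real (\<Sum>j<n. j)) / real n = pi * (real n * real (n - 1)) / real n"
    by (simp only:)
  also have "\<dots> = real (n - 1) * pi" using n by simp
  finally have "root_exp n (int (\<Sum>j<n. j)) = cis pi ^ (n - 1)"
    by (simp add: root_exp_def Complex.DeMoivre mult_ac del: cis_pi of_nat_sum)
  then show ?thesis by simp
qed

text \<open>The shift by (m - 1) n (n - 1) / 2 contributes the sign (-1)^((n - 1) (m - 1) s).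
  Together with the sign on the left it becomes the one in \<open>signed_binomial\<close>, the U of
  the overview.\<close>

lemma card_H_set_root_exp:
  assumes m: "m \<ge> 1" and n: "n > 0" and d: "coprime d (int n)"
  shows "of_int ((- 1) ^ ((m - 1) * n) * int (n\<^sup>2 * card (H_set m n d))) =
    (\<Sum>s<n. root_exp n (int s * d) * of_int (signed_binomial m (gcd s n)))"
proof -
  define T where "T = int (\<Sum>j<n. j)"
  have sign: "(- 1) ^ ((m - 1) * n) * root_exp n (int s * (d - (int m - 1) * T)) =
      root_exp n (int s * d) * (- 1) ^ ((m - 1) * gcd s n)" for s
  proof -
    have "root_exp n (int s * (d - (int m - 1) * T)) * root_exp n (int ((m - 1) * s) * T) = root_exp n (int s * d)"
      using m by (simp add: algebra_simps of_nat_diff flip: root_exp_add)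
    moreover have "root_exp n (int ((m - 1) * s) * T) = (- 1) ^ ((n - 1) * ((m - 1) * s))"
      using root_exp_triangular[OF n] by (simp only: T_def power_mult flip: root_exp_power)
    ultimately have rot: "root_exp n (int s * (d - (int m - 1) * T)) =
        root_exp n (int s * d) * (- 1) ^ ((n - 1) * ((m - 1) * s))"
      by (metis (no_types, opaque_lifting) mult.assoc mult.right_neutral left_minus_one_mult_self mult.commute)
    \<comment> \<open>For even n both sides have the parity of k s, as gcd s n is even exactly when
      s is; for odd n both have the parity of k.\<close>
    have parity: "even (k * n + (n - 1) * (k * s)) \<longleftrightarrow> even (k * gcd s n)" for k
      using n by (cases "even n") auto
    have "(- 1) ^ ((m - 1) * n + (n - 1) * ((m - 1) * s)) = ((- 1) ^ ((m - 1) * gcd s n) :: complex)"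
      using parity[of "m - 1"] by (simp only: minus_one_power_iff)
    then show ?thesis by (simp add: rot power_add mult.left_commute)
  qed
  have "of_int ((- 1) ^ ((m - 1) * n) * int (n\<^sup>2 * card (H_set m n d))) =
      (- 1) ^ ((m - 1) * n) * (of_nat n * of_nat (card (step_seqs m n d)) :: complex)"
    using H_set_card(2)[OF m n d] by (simp add: power2_eq_square mult.assoc flip: of_nat_mult)
  also have "\<dots> = (\<Sum>s<n. ((- 1) ^ ((m - 1) * n) * root_exp n (int s * (d - (int m - 1) * T))) *
      of_nat ((m * gcd s n - 1) choose (gcd s n - 1)))"
    by (simp only: card_step_seqs[OF m n] T_def sum_distrib_left mult.assoc)
  also have "\<dots> = (\<Sum>s<n. root_exp n (int s * d) * of_int (signed_binomial m (gcd s n)))"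
    unfolding sign by (simp add: signed_binomial_def mult.assoc)
  finally show ?thesis .
qed

text \<open>Multiplication by d permutes the residues modulo n and preserves their gcd with
  n.\<close>

lemma sum_root_exp_coprime:
  assumes n: "n > 0" and d: "coprime d (int n)"
  shows "(\<Sum>s<n. root_exp n (int s * d) * f (gcd s n)) = (\<Sum>s<n. root_exp n (int s) * f (gcd s n))"
proof -
  define h where "h s = nat (int s * d mod int n)" for s
  have h: "int (h s) = int s * d mod int n" for s using n by (simp add: h_def)
  have "inj_on h {..<n}"
  proof (rule inj_onI)
    fix s t assume st: "s \<in> {..<n}" "t \<in> {..<n}" "h s = h t"
    then have "int s * d mod int n = int t * d mod int n" using h by metis
    then have "int n dvd d * (int s - int t)" by (simp add: mod_eq_dvd_iff algebra_simps)
    then have "int n dvd int s - int t" using d by (simp add: coprime_dvd_mult_right_iff coprime_commute)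
    then show "s = t" using st by (simp flip: mod_eq_dvd_iff)
  qed
  moreover have "h ` {..<n} \<subseteq> {..<n}"
  proof safe
    fix s
    have "int (h s) < int n" using n h by simp
    then show "h s < n" by simp
  qed
  ultimately have "bij_betw h {..<n} {..<n}"
    by (simp add: bij_betw_def endo_inj_surj)
  then have "(\<Sum>s<n. root_exp n (int s) * f (gcd s n)) = (\<Sum>s<n. root_exp n (int (h s)) * f (gcd (h s) n))"
    by (rule sum.reindex_bij_betw[symmetric])
  also have "\<dots> = (\<Sum>s<n. root_exp n (int s * d) * f (gcd s n))"
  proof (intro sum.cong refl arg_cong2[of _ _ _ _ "(*)"] arg_cong[of _ _ f])
    fix s
    show "root_exp n (int (h s)) = root_exp n (int s * d)"
      unfolding h using n by (intro root_exp_cong) (simp_all add: mod_eq_dvd_iff[symmetric])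
    have "int (gcd (h s) n) = gcd (int s * d) (int n)" by (metis gcd.commute gcd_int_int_eq gcd_red_int h)
    also have "\<dots> = gcd (int s) (int n)"
      using d by (simp add: coprime_commute gcd_mult_left_right_cancel)
    finally show "gcd (h s) n = gcd s n" by simp
  qed
  finally show ?thesis by simp
qed

text \<open>The terms at s = 0 and s = n agree. The range from 1 to n is the one that suits the
  involution on divisors and residues.\<close>

lemma sum_root_exp_shift:
  assumes n: "n > 0"
  shows "(\<Sum>s<n. root_exp n (int s) * f (gcd s n)) = (\<Sum>s=1..n. root_exp n (int s) * f (gcd s n))"
    (is "sum ?f _ = _")
proof -
  have eq: "?f n = ?f 0" using n by (simp add: root_exp_eq_1_iff)
  have "sum ?f {..<n} + ?f n = ?f 0 + sum ?f {1..n}"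
    using sum.lessThan_Suc_shift[of ?f n] by (simp add: sum.atLeast1_atMost_eq)
  then have "sum ?f {..<n} + ?f 0 = sum ?f {1..n} + ?f 0" unfolding eq by (simp only: add.commute)
  then show ?thesis by (rule add_right_imp_eq)
qed

lemma root_exp_div:
  assumes "q dvd N" "N > 0"
  shows "root_exp (N div q) k = root_exp N (int q * k)"
proof -
  obtain e where e: "N = q * e" using assms(1) by (auto elim: dvdE)
  then show ?thesis using assms(2) by (simp add: root_exp_def mult.assoc)
qed

text \<open>Writing \<open>q = N div n\<close> for the cofactor of a divisor, the map
  \<open>(q, s) \<mapsto> (g, s * q div g)\<close> with \<open>g = gcd s (N div q)\<close> is an involution that preserves
  the fraction \<open>s * q / N\<close> and turns \<open>g\<close> into the first component.\<close>
lemma divisor_sum_root_exp: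
  assumes N: "N > 0"
  shows "(\<Sum>n | n dvd N. \<Sum>s<n. root_exp n (int s) * f (gcd s n)) = f N"
proof -
  define B where "B = (SIGMA q:{q. q dvd N}. {1..N div q})"
  define \<phi> where "\<phi> = (\<lambda>(q, s). let g = gcd s (N div q) in (g, s * q div g))"
  have fin: "finite {q. q dvd N}" using N by simp
  have \<phi>: "\<phi> x \<in> B \<and> \<phi> (\<phi> x) = x \<and> snd (\<phi> x) * fst (\<phi> x) = snd x * fst x" if x_in: "x \<in> B" for x
  proof -
    obtain q s where x: "x = (q, s)" by (cases x)
    obtain e where e: "N = q * e" using x_in x by (auto simp: B_def elim: dvdE)
    have q: "q > 0" "e > 0" using N e by auto
    define g where "g = gcd s e"
    have g: "g > 0" using q by (simp add: g_def)
    obtain a b where ab: "s = g * a" "e = g * b" "coprime a b"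
      using gcd_coprime_exists[of s e] g unfolding g_def by (metis less_numeral_extra(3) mult.commute)
    have s: "1 \<le> s" "s \<le> e" using x_in q by (auto simp: B_def x e)
    have "gcd (g * a) (g * b) = g" using ab(3) by (simp flip: gcd_mult_distrib_nat)
    then have \<phi>x: "\<phi> x = (g, a * q)"
      using q g by (simp add: x \<phi>_def e ab Let_def mult.assoc)
    have "gcd (a * q) (b * q) = q" using ab(3) by (simp add: mult.commute[of _ q] flip: gcd_mult_distrib_nat)
    moreover have "N div g = b * q" using g by (simp add: e ab)
    ultimately have "\<phi> (\<phi> x) = x" using q unfolding \<phi>x by (simp add: \<phi>_def x ab)
    moreover have "\<phi> x \<in> B" using s g q by (simp add: \<phi>x B_def e ab)
    moreover have "snd (\<phi> x) * fst (\<phi> x) = snd x * fst x" unfolding \<phi>x by (simp add: x ab)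
    ultimately show ?thesis by blast
  qed
  have "(\<Sum>n | n dvd N. \<Sum>s<n. root_exp n (int s) * f (gcd s n)) =
      (\<Sum>n | n dvd N. \<Sum>s=1..n. root_exp n (int s) * f (gcd s n))"
    using N by (intro sum.cong sum_root_exp_shift) (auto intro: Nat.gr0I)
  also have "\<dots> = (\<Sum>q | q dvd N. \<Sum>s=1..N div q. root_exp (N div q) (int s) * f (gcd s (N div q)))"
    by (rule sum.reindex_bij_witness[of _ "\<lambda>q. N div q" "\<lambda>n. N div n"])
      (use N in \<open>auto\<close>)
  also have "\<dots> = (\<Sum>(q, s)\<in>B. root_exp N (int (s * q)) * f (gcd s (N div q)))"
    unfolding B_def using fin N by (subst sum.Sigma[symmetric]) (auto intro!: sum.cong simp: root_exp_div mult.commute)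
  also have "\<dots> = (\<Sum>(q, s)\<in>B. root_exp N (int (s * q)) * f q)"
  proof (rule sum.reindex_bij_witness[of _ \<phi> \<phi>])
    fix x assume "x \<in> B"
    then show "\<phi> x \<in> B" "\<phi> (\<phi> x) = x" "\<phi> x \<in> B" "\<phi> (\<phi> x) = x" using \<phi> by simp_all
    have "fst (\<phi> x) = gcd (snd x) (N div fst x)" by (simp add: \<phi>_def case_prod_beta Let_def)
    then show "(case \<phi> x of (q, s) \<Rightarrow> root_exp N (int (s * q)) * f q) =
        (case x of (q, s) \<Rightarrow> root_exp N (int (s * q)) * f (gcd s (N div q)))"
      using \<phi>[OF \<open>x \<in> B\<close>] by (simp only: case_prod_beta)
  qed
  \<comment> \<open>The argument of \<open>f\<close> no longer depends on s, so the inner sum runs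
    over all roots of unity of order dividing N / q and vanishes unless q = N.\<close>
  also have "\<dots> = (\<Sum>q | q dvd N. f q * (\<Sum>s=1..N div q. root_exp (N div q) (int s)))"
    unfolding B_def using fin N
    by (subst sum.Sigma[symmetric]) (auto intro!: sum.cong simp: root_exp_div mult.commute sum_distrib_left)
  also have "\<dots> = (\<Sum>q | q dvd N. if q = N then f q else 0)"
  proof (intro sum.cong refl)
    fix q assume "q \<in> {q. q dvd N}"
    then obtain e where e: "N = q * e" by (auto elim: dvdE)
    then have e0: "e > 0" "q > 0" using N by auto
    have "(\<Sum>s=1..e. root_exp e (int s)) = (if e = 1 then 1 else 0)"
      using sum_root_exp[OF e0(1), of 1] sum_root_exp_shift[OF e0(1), of "\<lambda>_. 1"] by auto
    then show "f q * (\<Sum>s=1..N div q. root_exp (N div q) (int s)) = (if q = N then f q else 0)"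
      using e e0 by simp
  qed
  also have "\<dots> = f N" using fin by simp
  finally show ?thesis .
qed

theorem theorem7p1:
  fixes m n :: nat and d :: int
  assumes "m \<ge> 1" and "n \<ge> 1" and "coprime d (int n)"
  shows "finite (H_set m n d) \<and> rat_of_nat (card (H_set m n d)) = DT m n"
proof
  show "finite (H_set m n d)" using H_set_card(1)[of m n d] assms by simp
  \<comment> \<open>\<open>DT_eqI\<close> needs counts for all k at once. Only the degree at n is
    prescribed; elsewhere 1 is coprime to every k.\<close>
  define c :: "nat \<Rightarrow> int" where "c k = (if k = n then d else 1)" for k
  \<comment> \<open>The value 0 at k = 0 matches the pinned entry of \<open>DT\<close>.\<close>
  define h where "h k = (if k = 0 then 0 else card (H_set m k (c k)))" for k
  have c: "coprime (c k) (int k)" for k using assms(3) by (simp add: c_def)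
  have "DT m = (\<lambda>k. rat_of_nat (h k))"
  proof (rule DT_eqI[OF assms(1)])
    fix N :: nat assume N: "N \<ge> 1"
    have "of_int (\<Sum>k | k dvd N. (- 1) ^ ((m - 1) * k) * int (k\<^sup>2 * h k)) =
        (\<Sum>k | k dvd N. \<Sum>s<k. root_exp k (int s) * of_int (signed_binomial m (gcd s k)))"
      unfolding of_int_sum
    proof (intro sum.cong refl)
      fix k assume "k \<in> {k. k dvd N}"
      then have k: "k > 0" using N by (auto intro: Nat.gr0I)
      show "of_int ((- 1) ^ ((m - 1) * k) * int (k\<^sup>2 * h k)) =
          (\<Sum>s<k. root_exp k (int s) * of_int (signed_binomial m (gcd s k)))"
        using card_H_set_root_exp[OF assms(1) k c] sum_root_exp_coprime[OF k c, of "\<lambda>g. of_int (signed_binomial m g)"] k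
        by (simp add: h_def)
    qed
    also have "\<dots> = of_int (signed_binomial m N)"
      using N by (intro divisor_sum_root_exp) simp
    \<comment> \<open>The identity was derived in the complex numbers; both sides are integers, so
      it descends to the integers and then passes to the rationals.\<close>
    finally have "(\<Sum>k | k dvd N. (- 1) ^ ((m - 1) * k) * int (k\<^sup>2 * h k)) = signed_binomial m N"
      unfolding of_int_eq_iff .
    then have "rat_of_int (\<Sum>k | k dvd N. (- 1) ^ ((m - 1) * k) * int (k\<^sup>2 * h k)) = rat_of_int (signed_binomial m N)"
      by simp
    then show "(\<Sum>k | k dvd N. (- 1) ^ ((m - 1) * k) * of_nat (k\<^sup>2) * rat_of_nat (h k)) =
        (- 1) ^ ((m - 1) * N) * of_nat ((m * N - 1) choose (N - 1))"
      by (simp add: signed_binomial_def mult.assoc)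
  qed (simp add: h_def)
  then show "rat_of_nat (card (H_set m n d)) = DT m n"
    using assms(2) by (simp add: h_def c_def)
qed

end
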